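(* The optimal interdiction value function $y$ of the parametric matroid one-interdiction problem has, in the worst case, at least $\Omega(mk^{1/3})$ many changepoints. That is, there is an absolute constant $c>0$ such that there exist instances, with number of elements $m$ and rank $k$ arbitrarily large, consisting of a matroid $\mathcal{M}$ with $m$ elements and rank $k$ and parametric weights $w(e,\lambda)=a_e+\lambda b_e$, for which $y$ has at least $c\,mk^{1/3}$ changepoints.
   Context: $\mathcal{M}=(E,\mathcal{F})$ is a matroid on a finite ground set $E$ with independent sets $\mathcal{F}$, $m=|E|$, and $k$ is its rank. $I\subseteq\mathbb{R}$ is an interval (possibly all of $\mathbb{R}$), and each $e\in E$ has weight $w(e,\lambda)=a_e+\lambda b_e$ with $a_e,b_e\in\mathbb{Q}$, $\lambda\in I$. For a basis $B$, $w(B,\lambda)=\sum_{e\in B}w(e,\lambda)$. For $e\in E$, $\mathcal{M}_e$ is the restriction of $\mathcal{M}$ to $E\setminus\{e\}$; it is assumed that $\mathcal{M}_e$ has a basis of cardinality $k$ for every $e\in E$. $B_\lambda^e$ is a minimum weight basis of $\mathcal{M}_e$ at $\lambda$, and $y_e(\lambda)=w(B_\lambda^e,\lambda)$. The optimal interdiction value function is $y:I\to\mathbb{R}$, $y(\lambda)=\max\{y_e(\lambda): e\in E\}$; it is continuous and piecewise linear. The points of slope change of $y$ are called changepoints. *)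

theory Defs
  imports "HOL-Analysis.Analysis"
begin

locale matroid =
  fixes E :: "'a set" and \<F> :: "'a set set"
  assumes finite_ground: "finite E"
    and indep_subset: "X \<in> \<F> \<Longrightarrow> X \<subseteq> E"
    and indep_empty: "{} \<in> \<F>"
    and indep_mono: "\<lbrakk>X \<in> \<F>; Y \<subseteq> X\<rbrakk> \<Longrightarrow> Y \<in> \<F>"
    and indep_augment: "\<lbrakk>X \<in> \<F>; Y \<in> \<F>; card X < card Y\<rbrakk> \<Longrightarrow> \<exists>x\<in>Y - X. insert x X \<in> \<F>"

definition bases :: "'a set set \<Rightarrow> 'a set set" where
  "bases \<F> = {B \<in> \<F>. \<forall>X\<in>\<F>. B \<subseteq> X \<longrightarrow> X = B}"

definition matroid_rank :: "'a set set \<Rightarrow> nat" where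
  "matroid_rank \<F> = Max (card ` \<F>)"

definition restriction :: "'a set set \<Rightarrow> 'a set \<Rightarrow> 'a set set" where
  "restriction \<F> S = {X \<in> \<F>. X \<subseteq> S}"

definition weight :: "('a \<Rightarrow> real) \<Rightarrow> ('a \<Rightarrow> real) \<Rightarrow> 'a \<Rightarrow> real \<Rightarrow> real" where
  "weight a b e l = a e + l * b e"

definition set_weight :: "('a \<Rightarrow> real) \<Rightarrow> ('a \<Rightarrow> real) \<Rightarrow> 'a set \<Rightarrow> real \<Rightarrow> real" where
  "set_weight a b B l = (\<Sum>e\<in>B. weight a b e l)"

locale interdiction_instance = matroid E \<F>
  for E :: "'a set" and \<F> :: "'a set set" +
  fixes I :: "real set" and a b :: "'a \<Rightarrow> real"
  assumes interval: "is_interval I"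
    and rational: "e \<in> E \<Longrightarrow> a e \<in> \<rat> \<and> b e \<in> \<rat>"
    and full_rank_deletion: "e \<in> E \<Longrightarrow> \<exists>B\<in>bases (restriction \<F> (E - {e})). card B = matroid_rank \<F>"

text \<open>The minimum weight basis chosen by \<^const>\<open>arg_min_on\<close> need not be unique, but its weight is.\<close>

definition opt_basis ::
  "'a set \<Rightarrow> 'a set set \<Rightarrow> ('a \<Rightarrow> real) \<Rightarrow> ('a \<Rightarrow> real) \<Rightarrow> 'a \<Rightarrow> real \<Rightarrow> 'a set" where
  "opt_basis E \<F> a b e l =
     arg_min_on (\<lambda>B. set_weight a b B l) (bases (restriction \<F> (E - {e})))"

definition deletion_value ::
  "'a set \<Rightarrow> 'a set set \<Rightarrow> ('a \<Rightarrow> real) \<Rightarrow> ('a \<Rightarrow> real) \<Rightarrow> 'a \<Rightarrow> real \<Rightarrow> real" where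
  "deletion_value E \<F> a b e l = set_weight a b (opt_basis E \<F> a b e l) l"

definition interdiction_value ::
  "'a set \<Rightarrow> 'a set set \<Rightarrow> ('a \<Rightarrow> real) \<Rightarrow> ('a \<Rightarrow> real) \<Rightarrow> real \<Rightarrow> real" where
  "interdiction_value E \<F> a b l = Max ((\<lambda>e. deletion_value E \<F> a b e l) ` E)"

text \<open>For a continuous piecewise linear function on \<open>I\<close>: the slope \<open>s\<close> immediately to the left
  of \<open>l\<close> differs from the slope \<open>t\<close> immediately to the right. End points of \<open>I\<close> are thus excluded.\<close>

definition changepoints :: "real set \<Rightarrow> (real \<Rightarrow> real) \<Rightarrow> real set" where
  "changepoints I y = {l. \<exists>d>0. \<exists>s t. s \<noteq> t \<and> {l - d..l + d} \<subseteq> I \<and>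
     (\<forall>x\<in>{l - d..l}. y x = y l + s * (x - l)) \<and>
     (\<forall>x\<in>{l..l + d}. y x = y l + t * (x - l))}"

end

theory Submission
  imports Defs
begin

text \<open>
  Regard the weight of an element as a line over the parameter axis. In a transversal matroid whose
  family \<open>A c\<close>, \<open>c \<in> C\<close>, has a system of distinct representatives, every basis
  consists of one line from each \<open>A c\<close>, so its weight is at least the sum of the lower envelopes of
  the sets \<open>A c\<close>. This bound is attained at \<open>l\<close> as soon as the lines realising the
  envelopes at \<open>l\<close> can be chosen distinct. All envelopes are concave, so changes of slope cannot
  cancel, and the optimal weight has a changepoint wherever some envelope has a corner
  (\<open>changepoints_sum_lower_envelopes\<close>). The sets \<open>A c\<close> may overlap: a line may contribute to many
  envelopes, at different parameters. This reduces the problem to a point-line configuration with many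
  incidences.

  The index set is a grid of \<open>n\<^sup>3\<close> points, \<open>n\<close> wide and \<open>n\<^sup>2\<close> high, and \<open>A p\<close> consists of
  the lines through \<open>p\<close> of slopes \<open>-1, \<dots>, n\<close>. Only \<open>O(n\<^sup>3)\<close> different lines of slopes
  \<open>0, \<dots>, n - 1\<close> occur, because such a line is shared by about \<open>n\<close> points; the lines of the two
  extreme slopes are private to their point. Raising each line by a small strictly
  convex function of its slope opens every pencil into a concave chain on which all its lines appear
  (\<open>both_active_at_corner\<close>). A shared line appears on the chain of \<open>p\<close> only close to the
  abscissa of \<open>p\<close>, while the points sharing it have different abscissae; hence
  the envelopes are always realised by distinct lines (\<open>active_sdr\<close>). A second, still smaller
  perturbation makes the \<open>n\<^sup>3 * (n + 1)\<close> corners pairwise different (\<open>inj_on_corner\<close>). With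
  \<open>O(n\<^sup>3)\<close> elements and rank about \<open>n\<^sup>3\<close> this has the claimed order of magnitude.

  Interdiction enters through one additional direct summand with two elements, one of weight
  zero and one so expensive that on the bounded parameter interval deleting the free one is always the most
  harmful choice. The interdiction value is then the optimal weight of the rest plus a
  constant (\<open>guarded_transversal_instance\<close>).
\<close>

section \<open>Transversal matroids\<close>

definition sdr :: "'c set \<Rightarrow> ('c \<Rightarrow> 'a set) \<Rightarrow> ('c \<Rightarrow> 'a) \<Rightarrow> bool" where
  "sdr C A r \<longleftrightarrow> inj_on r C \<and> (\<forall>c\<in>C. r c \<in> A c)"

definition partial_transversals :: "'c set \<Rightarrow> ('c \<Rightarrow> 'a set) \<Rightarrow> 'a set set" where
  "partial_transversals C A = {X. \<exists>f. inj_on f X \<and> f ` X \<subseteq> C \<and> (\<forall>x\<in>X. x \<in> A (f x))}"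

lemma partial_transversal_card_le:
  assumes "finite C" "X \<in> partial_transversals C A"
  shows "finite X" "card X \<le> card C"
proof -
  obtain f where f: "inj_on f X" "f ` X \<subseteq> C"
    using assms(2) unfolding partial_transversals_def by blast
  show "finite X" using f assms(1) by (metis finite_imageD finite_subset)
  show "card X \<le> card C" using f assms(1) by (metis card_image card_mono)
qed

text \<open>Let \<open>f\<close> and \<open>g\<close> match \<open>X\<close> and \<open>Y\<close> into the index set. Since \<open>Y\<close> is larger, some
\<open>y \<in> Y\<close> has an index \<open>g y\<close> that \<open>f\<close> leaves free. Either \<open>y\<close> is new and
\<open>f\<close> extends to it, or \<open>y\<close> lies in \<open>X\<close> and can be rematched to \<open>g y\<close>; the latter
makes \<open>f\<close> agree with \<open>g\<close> at one more point, so it happens only finitely often.\<close>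

lemma partial_transversals_augment:
  assumes C: "finite C" and X: "X \<in> partial_transversals C A" and Y: "Y \<in> partial_transversals C A"
    and less: "card X < card Y"
  shows "\<exists>y\<in>Y - X. insert y X \<in> partial_transversals C A"
proof -
  note fin = partial_transversal_card_le(1)[OF C X] partial_transversal_card_le(1)[OF C Y]
  obtain g where g: "inj_on g Y" "g ` Y \<subseteq> C" "\<forall>y\<in>Y. y \<in> A (g y)"
    using Y unfolding partial_transversals_def by blast
  obtain f where "inj_on f X" "f ` X \<subseteq> C" "\<forall>x\<in>X. x \<in> A (f x)"
    using X unfolding partial_transversals_def by blast
  then show ?thesis
  proof (induction "card {x \<in> X. f x \<noteq> g x}" arbitrary: f rule: less_induct)
    case less
    have "card (f ` X) < card (g ` Y)"
      using less.prems(1) g(1) \<open>card X < card Y\<close> by (simp add: card_image)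
    then have "\<not> g ` Y \<subseteq> f ` X"
      using fin by (meson card_mono finite_imageI leD)
    then obtain y where y: "y \<in> Y" "g y \<notin> f ` X" by blast
    show ?case
    proof (cases "y \<in> X")
      case False
      let ?f = "f(y := g y)"
      have "?f ` X = f ` X" "inj_on ?f X"
        using False less.prems(1) by (auto simp: inj_on_def)
      then have "inj_on ?f (insert y X)" "?f ` insert y X \<subseteq> C"
        using less.prems(2) g(2) y False by auto
      moreover have "\<forall>x\<in>insert y X. x \<in> A (?f x)"
        using less.prems(3) g(3) y by simp
      ultimately have "insert y X \<in> partial_transversals C A"
        unfolding partial_transversals_def by blast
      then show ?thesis using y False by blast
    next
      case True
      let ?f = "f(y := g y)"
      have "f y \<noteq> g y" using True y(2) by (metis imageI)
      then have "{x \<in> X. ?f x \<noteq> g x} \<subset> {x \<in> X. f x \<noteq> g x}"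
        using True by (auto split: if_splits)
      then have "card {x \<in> X. ?f x \<noteq> g x} < card {x \<in> X. f x \<noteq> g x}"
        using fin by (intro psubset_card_mono) auto
      moreover have "inj_on ?f X"
        using less.prems(1) y(2) by (rule inj_on_fun_updI)
      moreover have "?f ` X \<subseteq> C"
        using less.prems(2) g(2) y(1) by auto
      moreover have "\<forall>x\<in>X. x \<in> A (?f x)"
        using less.prems(3) g(3) y(1) by simp
      ultimately show ?thesis by (rule less.hyps)
    qed
  qed
qed

lemma matroid_partial_transversals:
  assumes "finite C" "\<And>c. c \<in> C \<Longrightarrow> finite (A c)"
  shows "matroid (\<Union>c\<in>C. A c) (partial_transversals C A)"
proof
  show "finite (\<Union>c\<in>C. A c)" using assms by blast
  show "X \<subseteq> (\<Union>c\<in>C. A c)" if "X \<in> partial_transversals C A" for X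
    using that unfolding partial_transversals_def by blast
  show "{} \<in> partial_transversals C A"
    unfolding partial_transversals_def by simp
  show "Y \<in> partial_transversals C A" if "X \<in> partial_transversals C A" "Y \<subseteq> X" for X Y
    using that unfolding partial_transversals_def by (blast intro: inj_on_subset)
qed (rule partial_transversals_augment[OF assms(1)])

lemma sdr_image:
  assumes "sdr C A r"
  shows "r ` C \<in> partial_transversals C A" "card (r ` C) = card C"
proof -
  have r: "inj_on r C" "\<forall>c\<in>C. r c \<in> A c" using assms by (auto simp: sdr_def)
  show "card (r ` C) = card C" using r(1) by (rule card_image)
  have "inj_on (the_inv_into C r) (r ` C)" "the_inv_into C r ` (r ` C) \<subseteq> C"
    "\<forall>x\<in>r ` C. x \<in> A (the_inv_into C r x)"
    using r by (auto simp: inj_on_the_inv_into the_inv_into_f_f)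
  then show "r ` C \<in> partial_transversals C A"
    unfolding partial_transversals_def by blast
qed

lemma full_transversal_sdr:
  assumes C: "finite C" and X: "X \<in> partial_transversals C A" "card X = card C"
  obtains r where "sdr C A r" "X = r ` C"
proof -
  obtain f where f: "inj_on f X" "f ` X \<subseteq> C" "\<forall>x\<in>X. x \<in> A (f x)"
    using X unfolding partial_transversals_def by blast
  have "f ` X = C"
    using f X C by (metis card_image card_subset_eq)
  then have bij: "bij_betw f X C" using f(1) by (simp add: bij_betw_def)
  have "bij_betw (the_inv_into X f) C X" using bij by (rule bij_betw_the_inv_into)
  moreover have "\<forall>c\<in>C. the_inv_into X f c \<in> A c"
    using f(1,3) \<open>f ` X = C\<close> by (metis f_the_inv_into_f image_eqI the_inv_into_into order_refl)
  ultimately show ?thesis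
    using that[of "the_inv_into X f"] unfolding sdr_def bij_betw_def by auto
qed

lemma (in matroid) bases_restriction_eq:
  assumes "\<And>X. X \<in> \<F> \<Longrightarrow> card X \<le> k" and "X0 \<in> \<F>" "X0 \<subseteq> S" "card X0 = k"
  shows "bases (restriction \<F> S) = {X \<in> \<F>. X \<subseteq> S \<and> card X = k}"
proof (intro equalityI subsetI)
  fix X assume X: "X \<in> bases (restriction \<F> S)"
  then have X': "X \<in> \<F>" "X \<subseteq> S" by (auto simp: bases_def restriction_def)
  have "\<not> card X < k"
  proof
    assume "card X < k"
    then obtain x where x: "x \<in> X0 - X" "insert x X \<in> \<F>"
      using indep_augment[OF X'(1) assms(2)] assms(4) by auto
    then have "insert x X \<in> restriction \<F> S" using X' assms(3) by (auto simp: restriction_def)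
    with X x show False by (auto simp: bases_def)
  qed
  then show "X \<in> {X \<in> \<F>. X \<subseteq> S \<and> card X = k}"
    using X' assms(1)[OF X'(1)] by auto
next
  fix X assume X: "X \<in> {X \<in> \<F>. X \<subseteq> S \<and> card X = k}"
  have "Z = X" if "Z \<in> \<F>" "X \<subseteq> Z" for Z
  proof -
    have "finite Z" using that(1) finite_ground indep_subset finite_subset by blast
    moreover have "card Z \<le> card X" using assms(1)[OF that(1)] X by simp
    ultimately show ?thesis using that(2) card_seteq by blast
  qed
  then show "X \<in> bases (restriction \<F> S)"
    using X by (auto simp: bases_def restriction_def)
qed

lemma (in matroid) matroid_rank_eqI:
  assumes "\<And>X. X \<in> \<F> \<Longrightarrow> card X \<le> k" and "X0 \<in> \<F>" "card X0 = k"
  shows "matroid_rank \<F> = k"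
proof -
  have "finite \<F>"
    using finite_ground indep_subset by (meson Pow_iff finite_Pow_iff finite_subset subsetI)
  then show ?thesis
    unfolding matroid_rank_def using assms by (intro Max_eqI) auto
qed

lemma (in matroid) opt_basis_minimal:
  assumes "B \<in> bases (restriction \<F> (E - {e}))"
  shows "opt_basis E \<F> a b e l \<in> bases (restriction \<F> (E - {e}))"
    and "deletion_value E \<F> a b e l \<le> set_weight a b B l"
proof -
  have "bases (restriction \<F> (E - {e})) \<subseteq> Pow E"
    using indep_subset by (auto simp: bases_def restriction_def)
  then have fin: "finite (bases (restriction \<F> (E - {e})))"
    using finite_ground by (meson finite_Pow_iff finite_subset)
  have ne: "bases (restriction \<F> (E - {e})) \<noteq> {}" using assms by blast
  show "opt_basis E \<F> a b e l \<in> bases (restriction \<F> (E - {e}))"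
    unfolding opt_basis_def using arg_min_if_finite(1)[OF fin ne] .
  show "deletion_value E \<F> a b e l \<le> set_weight a b B l"
    unfolding deletion_value_def opt_basis_def using arg_min_least[OF fin ne assms] .
qed

section \<open>Interdiction value of a guarded transversal matroid\<close>

definition lower_envelope :: "('a \<Rightarrow> real) \<Rightarrow> ('a \<Rightarrow> real) \<Rightarrow> 'a set \<Rightarrow> real \<Rightarrow> real" where
  "lower_envelope a b S l = Min ((\<lambda>e. weight a b e l) ` S)"

lemma set_weight_sdr:
  "sdr C A r \<Longrightarrow> set_weight a b (r ` C) l = (\<Sum>c\<in>C. weight a b (r c) l)"
  unfolding set_weight_def sdr_def by (simp add: sum.reindex)

lemma abs_set_weight_le:
  assumes "finite U" "X \<subseteq> U" "\<bar>l\<bar> \<le> K"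
  shows "\<bar>set_weight a b X l\<bar> \<le> (\<Sum>e\<in>U. \<bar>a e\<bar> + K * \<bar>b e\<bar>)"
proof -
  have K: "K \<ge> 0" using assms(3) by linarith
  have "\<bar>set_weight a b X l\<bar> \<le> (\<Sum>e\<in>X. \<bar>weight a b e l\<bar>)"
    unfolding set_weight_def by (rule sum_abs)
  also have "\<dots> \<le> (\<Sum>e\<in>X. \<bar>a e\<bar> + K * \<bar>b e\<bar>)"
  proof (rule sum_mono)
    fix e
    have "\<bar>l * b e\<bar> \<le> K * \<bar>b e\<bar>"
      using assms(3) by (simp add: abs_mult mult_right_mono)
    then show "\<bar>weight a b e l\<bar> \<le> \<bar>a e\<bar> + K * \<bar>b e\<bar>"
      unfolding weight_def by linarith
  qed
  also have "\<dots> \<le> (\<Sum>e\<in>U. \<bar>a e\<bar> + K * \<bar>b e\<bar>)"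
    using assms K by (intro sum_mono2) auto
  finally show ?thesis .
qed

text \<open>The interdiction instance adjoins a new index with two new elements \<open>f\<close> and \<open>g\<close> of
weights \<open>0\<close> and \<open>M\<close>. Deleting \<open>f\<close> forces \<open>g\<close> into every basis and costs \<open>M\<close> plus the
optimum of the given family, which by \<open>opt\<close> is the sum of the envelopes. After any other
deletion \<open>f\<close> together with the representatives chosen by \<open>p\<close> or \<open>q\<close> is still a basis, and \<open>M\<close> bounds the
difference of the weights of any two transversals on the bounded set \<open>I\<close>. The disjointness of \<open>p\<close> and
\<open>q\<close> also ensures that no deletion lowers the rank.\<close>

lemma guarded_transversal_instance:
  fixes A :: "'c \<Rightarrow> nat set" and a b :: "nat \<Rightarrow> real"
  assumes C: "finite C" and A: "\<And>c. c \<in> C \<Longrightarrow> finite (A c)"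
    and rat: "\<And>c e. c \<in> C \<Longrightarrow> e \<in> A c \<Longrightarrow> a e \<in> \<rat> \<and> b e \<in> \<rat>"
    and I: "is_interval I" "bounded I"
    and pq: "sdr C A p" "sdr C A q" "p ` C \<inter> q ` C = {}"
    and opt: "\<And>l. l \<in> I \<Longrightarrow>
      \<exists>r. sdr C A r \<and> (\<forall>c\<in>C. weight a b (r c) l = lower_envelope a b (A c) l)"
  shows "\<exists>(E :: nat set) \<F> a' b' M. interdiction_instance E \<F> I a' b' \<and>
    card E = card (\<Union>c\<in>C. A c) + 2 \<and> matroid_rank \<F> = card C + 1 \<and>
    (\<forall>l\<in>I. interdiction_value E \<F> a' b' l = M + (\<Sum>c\<in>C. lower_envelope a b (A c) l))"
proof -
  define U where "U = (\<Union>c\<in>C. A c)"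
  have finU: "finite U" unfolding U_def using C A by blast
  obtain f where f: "f \<notin> U" using finU by (metis ex_new_if_finite infinite_UNIV_nat)
  obtain g where g: "g \<notin> insert f U"
    using finU by (metis ex_new_if_finite finite_insert infinite_UNIV_nat)
  obtain K :: nat where K: "\<And>l. l \<in> I \<Longrightarrow> \<bar>l\<bar> \<le> real K"
  proof -
    obtain K0 where "\<And>l. l \<in> I \<Longrightarrow> norm l \<le> K0" using I(2) by (auto simp: bounded_iff)
    then have "\<bar>l\<bar> \<le> real (nat \<lceil>K0\<rceil>)" if "l \<in> I" for l
      using that by (metis order_trans real_nat_ceiling_ge real_norm_def)
    then show ?thesis using that by blast
  qed
  \<comment> \<open>Transversals of the given family have weights between \<open>-M / 2\<close> and \<open>M / 2\<close> on \<open>I\<close>.\<close>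
  define M where "M = 2 * (\<Sum>e\<in>U. \<bar>a e\<bar> + real K * \<bar>b e\<bar>)"
  define D where "D = insert None (Some ` C)"
  define A' where "A' = case_option {f, g} A"
  define a' where "a' = a(f := 0, g := M)"
  define b' where "b' = b(f := 0, g := 0)"
  define E where "E = (\<Union>d\<in>D. A' d)"
  define \<F> where "\<F> = partial_transversals D A'"
  have A'_simps [simp]: "A' None = {f, g}" "A' (Some c) = A c" for c
    by (simp_all add: A'_def)
  have finD: "finite D" using C by (simp add: D_def)
  have finA': "finite (A' d)" if "d \<in> D" for d using that A by (auto simp: D_def)
  have cardD: "card D = card C + 1"
    using C by (simp add: D_def card_image)
  have E_eq: "E = {f, g} \<union> U" by (auto simp: E_def D_def U_def)
  have cardE: "card E = card U + 2" using f g finU by (simp add: E_eq)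
  interpret matroid E \<F>
    unfolding E_def \<F>_def by (rule matroid_partial_transversals[OF finD finA'])
  have w_f: "weight a' b' f l = 0" for l using g by (simp add: weight_def a'_def b'_def)
  have w_g: "weight a' b' g l = M" for l using g by (simp add: weight_def a'_def b'_def)
  have w_U: "weight a' b' e l = weight a b e l" if "e \<in> U" for e l
    using that f g by (auto simp: weight_def a'_def b'_def)
  have inU: "r c \<in> U" if "sdr C A r" "c \<in> C" for r c
    using that by (auto simp: sdr_def U_def)
  have ext: "sdr D A' (case_option h r)" if "sdr C A r" "h \<in> {f, g}" for h r
    using that f g inU[OF that(1)] by (auto simp: sdr_def D_def inj_on_def)
  have weight_sdr: "set_weight a' b' (r ` D) l =
      weight a' b' (r None) l + (\<Sum>c\<in>C. weight a b (r (Some c)) l)" if "sdr D A' r" for r l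
  proof -
    have "r (Some c) \<in> U" if "c \<in> C" for c
      using \<open>sdr D A' r\<close> that by (auto simp: sdr_def D_def U_def)
    then have "(\<Sum>c\<in>C. weight a' b' (r (Some c)) l) = (\<Sum>c\<in>C. weight a b (r (Some c)) l)"
      by (intro sum.cong refl w_U) auto
    then show ?thesis
      using C by (simp add: set_weight_sdr[OF that]) (simp add: D_def sum.reindex)
  qed
  have le_card: "card X \<le> card D" if "X \<in> \<F>" for X
    using partial_transversal_card_le(2)[OF finD] that by (simp add: \<F>_def)
  have rank: "matroid_rank \<F> = card D"
    using sdr_image[OF ext[OF pq(1)], of f] le_card by (intro matroid_rank_eqI) (auto simp: \<F>_def)
  have bases_iff: "bases (restriction \<F> (E - {e})) = {X \<in> \<F>. X \<subseteq> E - {e} \<and> card X = card D}"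
    if "sdr D A' r" "e \<notin> r ` D" for e r
  proof (rule bases_restriction_eq[OF le_card])
    show "r ` D \<in> \<F>" "card (r ` D) = card D" using sdr_image[OF that(1)] by (simp_all add: \<F>_def)
    then show "r ` D \<subseteq> E - {e}" using indep_subset that(2) by blast
  qed
  have basis: "r ` D \<in> bases (restriction \<F> (E - {e}))" if "sdr D A' r" "e \<notin> r ` D" for e r
    using sdr_image[OF that(1)] indep_subset[of "r ` D"] that(2)
    unfolding bases_iff[OF that] by (auto simp: \<F>_def)
  \<comment> \<open>Whichever element other than \<open>f\<close> is deleted, \<open>p\<close> or \<open>q\<close> avoids it.\<close>
  have avoid: "\<exists>r. sdr C A r \<and> e \<notin> case_option f r ` D" if "e \<noteq> f" for e
  proof -
    have "e \<notin> p ` C \<or> e \<notin> q ` C" using pq(3) by blast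
    then show ?thesis using pq(1,2) that by (auto simp: D_def image_image)
  qed
  have avoid_f: "f \<notin> case_option g r ` D" if "sdr C A r" for r
    using inU[OF that] f g by (auto simp: D_def)
  have inst: "interdiction_instance E \<F> I a' b'"
  proof
    show "is_interval I" by fact
    have M: "M \<in> \<rat>" unfolding M_def
      using rat by (intro Rats_mult Rats_sum Rats_add) (auto simp: U_def)
    show "a' e \<in> \<rat> \<and> b' e \<in> \<rat>" if "e \<in> E" for e
      using that rat M by (auto simp: E_eq U_def a'_def b'_def)
    show "\<exists>B\<in>bases (restriction \<F> (E - {e})). card B = matroid_rank \<F>" for e
    proof (cases "e = f")
      case True
      then show ?thesis
        using basis[OF ext[OF pq(1)] avoid_f[OF pq(1)]] sdr_image(2)[OF ext[OF pq(1)]] rank by auto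
    next
      case False
      then obtain r where "sdr C A r" "e \<notin> case_option f r ` D" using avoid by blast
      then show ?thesis
        using basis[OF ext] sdr_image(2)[OF ext, of r f] rank by auto
    qed
  qed
  have val: "interdiction_value E \<F> a' b' l = M + (\<Sum>c\<in>C. lower_envelope a b (A c) l)"
    if l: "l \<in> I" for l
  proof -
    let ?S = "\<Sum>c\<in>C. lower_envelope a b (A c) l"
    obtain r where r: "sdr C A r" "\<forall>c\<in>C. weight a b (r c) l = lower_envelope a b (A c) l"
      using opt[OF l] by blast
    have half: "\<bar>\<Sum>c\<in>C. weight a b (h c) l\<bar> \<le> M / 2" if "sdr C A h" for h
      using abs_set_weight_le[OF finU, of "h ` C" l "real K" a b] inU[OF that] K[OF l]
      by (auto simp: M_def set_weight_sdr[OF that])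
    have S_eq: "?S = (\<Sum>c\<in>C. weight a b (r c) l)" using r(2) by simp
    have f_eq: "deletion_value E \<F> a' b' f l = M + ?S"
    proof (rule antisym)
      have "deletion_value E \<F> a' b' f l \<le> set_weight a' b' (case_option g r ` D) l"
        by (rule opt_basis_minimal(2)[OF basis[OF ext avoid_f]]) (use r in auto)
      also have "\<dots> = M + ?S"
        using weight_sdr[OF ext[OF r(1)], of g l] by (simp add: w_g S_eq)
      finally show "deletion_value E \<F> a' b' f l \<le> M + ?S" .
      define X where "X = opt_basis E \<F> a' b' f l"
      have "X \<in> bases (restriction \<F> (E - {f}))"
        unfolding X_def by (rule opt_basis_minimal(1)[OF basis[OF ext avoid_f]]) (use r in auto)
      then have X: "X \<in> \<F>" "X \<subseteq> E - {f}" "card X = card D"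
        using bases_iff[OF ext avoid_f, OF r(1) _ r(1)] by auto
      obtain h where h: "sdr D A' h" "X = h ` D"
        using full_transversal_sdr[OF finD X(1)[unfolded \<F>_def] X(3)] by blast
      have hN: "h None = g"
        using h X(2) by (auto simp: sdr_def D_def)
      have "?S \<le> (\<Sum>c\<in>C. weight a b (h (Some c)) l)"
      proof (rule sum_mono)
        fix c assume "c \<in> C"
        then have "h (Some c) \<in> A c" using h(1) by (auto simp: sdr_def D_def)
        then show "lower_envelope a b (A c) l \<le> weight a b (h (Some c)) l"
          unfolding lower_envelope_def using A[OF \<open>c \<in> C\<close>] by (intro Min_le) auto
      qed
      then have "M + ?S \<le> set_weight a' b' X l"
        unfolding h(2) weight_sdr[OF h(1)] hN w_g by simp
      then show "M + ?S \<le> deletion_value E \<F> a' b' f l"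
        by (simp add: deletion_value_def X_def)
    qed
    have "deletion_value E \<F> a' b' e l \<le> M + ?S" for e
    proof (cases "e = f")
      case True
      then show ?thesis using f_eq by simp
    next
      case False
      then obtain h where h: "sdr C A h" "e \<notin> case_option f h ` D" using avoid by blast
      have "deletion_value E \<F> a' b' e l \<le> set_weight a' b' (case_option f h ` D) l"
        by (rule opt_basis_minimal(2)[OF basis[OF ext]]) (use h in auto)
      also have "\<dots> = (\<Sum>c\<in>C. weight a b (h c) l)"
        using weight_sdr[OF ext[OF h(1)], of f l] by (simp add: w_f)
      also have "\<dots> \<le> M + ?S" using half[OF h(1)] half[OF r(1)] S_eq by linarith
      finally show ?thesis .
    qed
    then show ?thesis
      unfolding interdiction_value_def using finite_ground f_eq E_eq
      by (intro Max_eqI) (auto simp: image_iff intro!: bexI[of _ f])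
  qed
  show ?thesis
  proof (intro exI conjI ballI)
    show "card E = card (\<Union>c\<in>C. A c) + 2" using cardE by (simp add: U_def)
    show "matroid_rank \<F> = card C + 1" using rank cardD by simp
  qed (rule inst, rule val)
qed

section \<open>Changepoints of a sum of lower envelopes\<close>

definition active :: "('a \<Rightarrow> real) \<Rightarrow> ('a \<Rightarrow> real) \<Rightarrow> 'a set \<Rightarrow> real \<Rightarrow> 'a set" where
  "active a b S l = {e \<in> S. weight a b e l = lower_envelope a b S l}"

lemma active_iff:
  assumes "finite S"
  shows "e \<in> active a b S l \<longleftrightarrow> e \<in> S \<and> (\<forall>e'\<in>S. weight a b e l \<le> weight a b e' l)"
proof -
  have "weight a b e l = Min ((\<lambda>e. weight a b e l) ` S)"
    if "e \<in> S" "\<forall>e'\<in>S. weight a b e l \<le> weight a b e' l"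
    using that assms by (intro Min_eqI[symmetric]) auto
  then show ?thesis
    using assms by (auto simp: active_def lower_envelope_def)
qed

lemma active_nonempty:
  assumes "finite S" "S \<noteq> {}"
  shows "active a b S l \<noteq> {}"
proof -
  have "Min ((\<lambda>e. weight a b e l) ` S) \<in> (\<lambda>e. weight a b e l) ` S"
    using assms by (intro Min_in) auto
  then show ?thesis by (force simp: active_def lower_envelope_def)
qed

text \<open>Close to \<open>l\<close> only lines active at \<open>l\<close> can realise the envelope, and all of these pass through the
same point. Instantiating the filter with the left and the right neighbourhoods of \<open>l\<close> treats both
sides at once.\<close>

lemma lower_envelope_germ:
  assumes S: "finite S" and F: "F \<le> nhds l" and e: "e \<in> active a b S l"
    and best: "\<And>e'. e' \<in> active a b S l \<Longrightarrow> \<forall>\<^sub>F x in F. b e * (x - l) \<le> b e' * (x - l)"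
  shows "\<forall>\<^sub>F x in F. lower_envelope a b S x = lower_envelope a b S l + b e * (x - l)"
proof -
  have wt: "weight a b u x = weight a b u l + b u * (x - l)" for u x
    by (simp add: weight_def algebra_simps)
  have "\<forall>\<^sub>F x in F. weight a b e x \<le> weight a b e' x" if e': "e' \<in> S" for e'
  proof (cases "e' \<in> active a b S l")
    case True
    then have eq: "weight a b e' l = weight a b e l" using e by (simp add: active_def)
    from best[OF True] show ?thesis
    proof eventually_elim
      case (elim x)
      then show ?case using wt[of e x] wt[of e' x] eq by linarith
    qed
  next
    case False
    then have lt: "weight a b e l < weight a b e' l"
      using e e' order_trans unfolding active_iff[OF S] by (meson not_le)
    define h where "h = (\<lambda>x. weight a b e' x - weight a b e x)"
    have "isCont h l"
      unfolding h_def weight_def by (intro continuous_intros)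
    then have "(h \<longlongrightarrow> h l) (nhds l)"
      by (simp add: isCont_def tendsto_at_iff_tendsto_nhds)
    moreover have "0 < h l" using lt by (simp add: h_def)
    ultimately have "\<forall>\<^sub>F x in nhds l. 0 < h x"
      by (rule order_tendstoD(1))
    then have "\<forall>\<^sub>F x in F. 0 < h x"
      using F by (rule filter_leD[rotated])
    then show ?thesis by eventually_elim (simp add: h_def)
  qed
  then have "\<forall>\<^sub>F x in F. \<forall>e'\<in>S. weight a b e x \<le> weight a b e' x"
    using S by (simp add: eventually_ball_finite_distrib)
  then show ?thesis
  proof eventually_elim
    case (elim x)
    then have "e \<in> active a b S x" using e S by (simp add: active_iff)
    then show ?case using e wt[of e x] by (simp add: active_def)
  qed
qed

text \<open>To the left of \<open>l\<close> the active line of largest slope is lowest, to the right the one of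
smallest slope.\<close>

lemma lower_envelope_sides:
  assumes S: "finite S" "S \<noteq> {}"
  shows "\<exists>e e'. e \<in> active a b S l \<and> e' \<in> active a b S l \<and>
    (\<forall>u\<in>active a b S l. b e' \<le> b u \<and> b u \<le> b e) \<and>
    (\<forall>\<^sub>F x in at_left l. lower_envelope a b S x = lower_envelope a b S l + b e * (x - l)) \<and>
    (\<forall>\<^sub>F x in at_right l. lower_envelope a b S x = lower_envelope a b S l + b e' * (x - l))"
proof -
  let ?T = "active a b S l"
  have T: "finite ?T" "?T \<noteq> {}" using S active_nonempty[OF S] by (auto simp: active_def)
  obtain e where e: "e \<in> ?T" "\<forall>u\<in>?T. b u \<le> b e"
    using T arg_min_if_finite(1)[of ?T "\<lambda>u. - b u"] arg_min_least[of ?T _ "\<lambda>u. - b u"]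
    by (meson neg_le_iff_le)
  obtain e' where e': "e' \<in> ?T" "\<forall>u\<in>?T. b e' \<le> b u"
    using T by (metis arg_min_if_finite(1) arg_min_least)
  have "\<forall>\<^sub>F x in at_left l. lower_envelope a b S x = lower_envelope a b S l + b e * (x - l)"
  proof (rule lower_envelope_germ[OF S(1) _ e(1)])
    show "at_left l \<le> nhds l" by (simp add: at_within_def)
    fix u assume u: "u \<in> ?T"
    have "\<forall>\<^sub>F x in at_left l. x < l" by (simp add: eventually_at_filter)
    then show "\<forall>\<^sub>F x in at_left l. b e * (x - l) \<le> b u * (x - l)"
      by eventually_elim (use e(2) u in \<open>simp add: mult_right_mono_neg\<close>)
  qed
  moreover have "\<forall>\<^sub>F x in at_right l. lower_envelope a b S x = lower_envelope a b S l + b e' * (x - l)"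
  proof (rule lower_envelope_germ[OF S(1) _ e'(1)])
    show "at_right l \<le> nhds l" by (simp add: at_within_def)
    fix u assume u: "u \<in> ?T"
    have "\<forall>\<^sub>F x in at_right l. l < x" by (simp add: eventually_at_filter)
    then show "\<forall>\<^sub>F x in at_right l. b e' * (x - l) \<le> b u * (x - l)"
      by eventually_elim (use e'(2) u in \<open>simp add: mult_right_mono\<close>)
  qed
  ultimately show ?thesis using e e' by blast
qed

lemma changepoints_iff_slopes:
  fixes I :: "real set"
  assumes "open I"
    and left: "\<forall>\<^sub>F x in at_left l. y x = y l + s * (x - l)"
    and right: "\<forall>\<^sub>F x in at_right l. y x = y l + t * (x - l)"
  shows "l \<in> changepoints I y \<longleftrightarrow> l \<in> I \<and> s \<noteq> t"
proof
  assume "l \<in> changepoints I y"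
  then obtain d s' t' where d: "d > 0" "s' \<noteq> t'" "{l - d..l + d} \<subseteq> I"
    "\<forall>x\<in>{l - d..l}. y x = y l + s' * (x - l)" "\<forall>x\<in>{l..l + d}. y x = y l + t' * (x - l)"
    unfolding changepoints_def by blast
  have "\<forall>\<^sub>F x in at_left l. x \<in> {l - d<..<l}"
    using d(1) by (intro eventually_at_leftI[of "l - d"]) auto
  with left have "\<forall>\<^sub>F x in at_left l. s = s'"
  proof eventually_elim
    case (elim x)
    have "y x = y l + s' * (x - l)"
      by (rule d(4)[rule_format]) (use elim(2) in auto)
    then have "s * (x - l) = s' * (x - l)" using elim(1) by linarith
    then show ?case using elim(2) by simp
  qed
  moreover have "\<forall>\<^sub>F x in at_right l. x \<in> {l<..<l + d}"
    using d(1) by (intro eventually_at_rightI[of l "l + d"]) auto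
  with right have "\<forall>\<^sub>F x in at_right l. t = t'"
  proof eventually_elim
    case (elim x)
    have "y x = y l + t' * (x - l)"
      by (rule d(5)[rule_format]) (use elim(2) in auto)
    then have "t * (x - l) = t' * (x - l)" using elim(1) by linarith
    then show ?case using elim(2) by simp
  qed
  ultimately have "s = s'" "t = t'" by (auto simp: eventually_const_iff)
  moreover have "l \<in> I" using d(1,3) by auto
  ultimately show "l \<in> I \<and> s \<noteq> t" using d(2) by simp
next
  assume l: "l \<in> I \<and> s \<noteq> t"
  obtain d0 where d0: "d0 > 0" "cball l d0 \<subseteq> I"
    using assms(1) l by (metis open_contains_cball)
  obtain u where u: "u < l" "\<And>x. u < x \<Longrightarrow> x < l \<Longrightarrow> y x = y l + s * (x - l)"
    using left by (auto simp: eventually_at_left_field)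
  obtain v where v: "l < v" "\<And>x. l < x \<Longrightarrow> x < v \<Longrightarrow> y x = y l + t * (x - l)"
    using right by (auto simp: eventually_at_right_field)
  define d where "d = min d0 (min ((l - u) / 2) ((v - l) / 2))"
  have d: "d > 0" "d \<le> d0" "l - d > u" "l + d < v"
    using d0 u(1) v(1) by (auto simp: d_def min_def field_simps)
  have "\<forall>x\<in>{l - d..l}. y x = y l + s * (x - l)"
  proof
    fix x assume "x \<in> {l - d..l}"
    then show "y x = y l + s * (x - l)" using u(2)[of x] d by (cases "x = l") auto
  qed
  moreover have "\<forall>x\<in>{l..l + d}. y x = y l + t * (x - l)"
  proof
    fix x assume "x \<in> {l..l + d}"
    then show "y x = y l + t * (x - l)" using v(2)[of x] d by (cases "x = l") auto
  qed
  moreover have "{l - d..l + d} \<subseteq> I"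
  proof
    fix x assume "x \<in> {l - d..l + d}"
    then have "x \<in> cball l d0" using d(2) by (auto simp: dist_real_def)
    then show "x \<in> I" using d0(2) by blast
  qed
  ultimately show "l \<in> changepoints I y"
    unfolding changepoints_def using d(1) l by blast
qed

text \<open>Each envelope contributes a left slope at least as large as its right slope. The difference for the sum is
therefore a sum of nonnegative terms, and it vanishes only if no envelope has a corner at \<open>l\<close>.\<close>

lemma changepoints_sum_lower_envelopes:
  assumes C: "finite C" and A: "\<And>c. c \<in> C \<Longrightarrow> finite (A c) \<and> A c \<noteq> {}"
    and I: "open I"
    and y: "\<And>l. l \<in> I \<Longrightarrow> y l = M + (\<Sum>c\<in>C. lower_envelope a b (A c) l)"
  shows "changepoints I y =
    {l \<in> I. \<exists>c\<in>C. \<exists>e\<in>active a b (A c) l. \<exists>e'\<in>active a b (A c) l. b e \<noteq> b e'}"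
proof -
  have iff: "l \<in> changepoints I y \<longleftrightarrow>
      (\<exists>c\<in>C. \<exists>e\<in>active a b (A c) l. \<exists>e'\<in>active a b (A c) l. b e \<noteq> b e')" if l: "l \<in> I" for l
  proof -
    define sides where "sides c e e' \<longleftrightarrow> e \<in> active a b (A c) l \<and> e' \<in> active a b (A c) l \<and>
      (\<forall>u\<in>active a b (A c) l. b e' \<le> b u \<and> b u \<le> b e) \<and>
      (\<forall>\<^sub>F x in at_left l. lower_envelope a b (A c) x = lower_envelope a b (A c) l + b e * (x - l)) \<and>
      (\<forall>\<^sub>F x in at_right l. lower_envelope a b (A c) x = lower_envelope a b (A c) l + b e' * (x - l))"
      for c e e'
    have "\<forall>c\<in>C. \<exists>e e'. sides c e e'"
      unfolding sides_def using A by (intro ballI lower_envelope_sides) auto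
    then obtain u v where sides: "\<And>c. c \<in> C \<Longrightarrow> sides c (u c) (v c)" by metis
    have uv: "u c \<in> active a b (A c) l" "v c \<in> active a b (A c) l"
        "\<forall>e\<in>active a b (A c) l. b (v c) \<le> b e \<and> b e \<le> b (u c)"
      and left: "\<forall>\<^sub>F x in at_left l.
        lower_envelope a b (A c) x = lower_envelope a b (A c) l + b (u c) * (x - l)"
      and right: "\<forall>\<^sub>F x in at_right l.
        lower_envelope a b (A c) x = lower_envelope a b (A c) l + b (v c) * (x - l)"
      if "c \<in> C" for c
      using sides[OF that] unfolding sides_def by blast+
    have nhI: "\<forall>\<^sub>F x in nhds l. x \<in> I" using I l by (rule eventually_nhds_in_open)
    have sum_germ: "\<forall>\<^sub>F x in F. y x = y l + (\<Sum>c\<in>C. b (h c)) * (x - l)"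
      if "F \<le> nhds l" and germs: "\<And>c. c \<in> C \<Longrightarrow>
        \<forall>\<^sub>F x in F. lower_envelope a b (A c) x = lower_envelope a b (A c) l + b (h c) * (x - l)"
      for F h
    proof -
      have "\<forall>\<^sub>F x in F. x \<in> I" using nhI that(1) by (rule filter_leD[rotated])
      moreover have "\<forall>\<^sub>F x in F. \<forall>c\<in>C.
          lower_envelope a b (A c) x = lower_envelope a b (A c) l + b (h c) * (x - l)"
        using C germs by (simp add: eventually_ball_finite_distrib)
      ultimately show ?thesis
        by eventually_elim (simp add: y l sum.distrib sum_distrib_right)
    qed
    have "l \<in> changepoints I y \<longleftrightarrow> l \<in> I \<and> (\<Sum>c\<in>C. b (u c)) \<noteq> (\<Sum>c\<in>C. b (v c))"
      by (intro changepoints_iff_slopes[OF I] sum_germ left right) (simp_all add: at_within_def)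
    also have "\<dots> \<longleftrightarrow> (\<exists>c\<in>C. b (u c) \<noteq> b (v c))"
    proof -
      have "(\<Sum>c\<in>C. b (u c)) = (\<Sum>c\<in>C. b (v c)) \<longleftrightarrow> (\<Sum>c\<in>C. b (u c) - b (v c)) = 0"
        by (simp add: sum_subtractf)
      also have "\<dots> \<longleftrightarrow> (\<forall>c\<in>C. b (u c) - b (v c) = 0)"
        using uv by (intro sum_nonneg_eq_0_iff[OF C]) auto
      finally show ?thesis using l by auto
    qed
    also have "\<dots> \<longleftrightarrow> (\<exists>c\<in>C. \<exists>e\<in>active a b (A c) l. \<exists>e'\<in>active a b (A c) l. b e \<noteq> b e')"
    proof (rule bex_cong[OF refl])
      fix c assume c: "c \<in> C"
      have same: "b e = b (u c)" if "b (u c) = b (v c)" "e \<in> active a b (A c) l" for e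
        using uv(3)[OF c, rule_format, OF that(2)] that(1) by linarith
      show "b (u c) \<noteq> b (v c) \<longleftrightarrow>
          (\<exists>e\<in>active a b (A c) l. \<exists>e'\<in>active a b (A c) l. b e \<noteq> b e')"
      proof
        assume "b (u c) \<noteq> b (v c)"
        then show "\<exists>e\<in>active a b (A c) l. \<exists>e'\<in>active a b (A c) l. b e \<noteq> b e'"
          using uv(1,2)[OF c] by (intro bexI)
      next
        assume "\<exists>e\<in>active a b (A c) l. \<exists>e'\<in>active a b (A c) l. b e \<noteq> b e'"
        then obtain e e' where e: "e \<in> active a b (A c) l" "e' \<in> active a b (A c) l" "b e \<noteq> b e'"
          by (elim bexE)
        show "b (u c) \<noteq> b (v c)"
        proof
          assume "b (u c) = b (v c)"
          from same[OF this e(1)] same[OF this e(2)] e(3) show False by simp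
        qed
      qed
    qed
    finally show ?thesis .
  qed
  have outside: "l \<notin> changepoints I y" if "l \<notin> I" for l
  proof
    assume l: "l \<in> changepoints I y"
    obtain d where "d > 0" "{l - d..l + d} \<subseteq> I"
      using l unfolding changepoints_def by (elim CollectE exE conjE)
    moreover from this have "l \<in> {l - d..l + d}" by simp
    ultimately have "l \<in> I" by (elim subsetD)
    with that show False ..
  qed
  show ?thesis
  proof (rule set_eqI)
    fix l
    show "l \<in> changepoints I y \<longleftrightarrow> l \<in> {l \<in> I. \<exists>c\<in>C.
      \<exists>e\<in>active a b (A c) l. \<exists>e'\<in>active a b (A c) l. b e \<noteq> b e'}"
      by (cases "l \<in> I") (simp only: iff mem_Collect_eq simp_thms, simp add: outside)
  qed
qed

text \<open>This makes the cardinality of the set of changepoints meaningful, since \<^const>\<open>card\<close> is zero on infinite sets.\<close>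

lemma finite_changepoints_sum_lower_envelopes:
  assumes C: "finite C" and A: "\<And>c. c \<in> C \<Longrightarrow> finite (A c) \<and> A c \<noteq> {}"
    and I: "open I"
    and y: "\<And>l. l \<in> I \<Longrightarrow> y l = M + (\<Sum>c\<in>C. lower_envelope a b (A c) l)"
  shows "finite (changepoints I y)"
proof -
  let ?U = "\<Union>c\<in>C. A c"
  have eq: "changepoints I y =
      {l \<in> I. \<exists>c\<in>C. \<exists>e\<in>active a b (A c) l. \<exists>e'\<in>active a b (A c) l. b e \<noteq> b e'}"
    by (rule changepoints_sum_lower_envelopes[OF C A I y])
  have "changepoints I y \<subseteq> (\<lambda>(e, e'). (a e' - a e) / (b e - b e')) ` (?U \<times> ?U)"
  proof
    fix l assume "l \<in> changepoints I y"
    then obtain c e e' where ce: "c \<in> C" "e \<in> active a b (A c) l" "e' \<in> active a b (A c) l" "b e \<noteq> b e'"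
      unfolding eq by blast
    then have "weight a b e l = weight a b e' l" by (simp add: active_def)
    then have "l = (a e' - a e) / (b e - b e')" using ce(4) by (simp add: weight_def field_simps)
    moreover have "e \<in> ?U" "e' \<in> ?U" using ce by (auto simp: active_def)
    ultimately show "l \<in> (\<lambda>(e, e'). (a e' - a e) / (b e - b e')) ` (?U \<times> ?U)" by force
  qed
  moreover have "finite ?U" using C A by blast
  ultimately show ?thesis by (meson finite_SigmaI finite_imageI finite_subset)
qed

section \<open>A pencil of slightly perturbed lines at every grid point\<close>

text \<open>The scales of the two perturbations. The larger one, \<open>eps\<close>, keeps all corners of a pencil within distance
\<open>1 / 2\<close> of the abscissa of its point; the smaller one, \<open>eta\<close>, moves every corner by at
most \<open>eps / 2\<close>, which is too little to make corners of different slopes in one column meet.\<close>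

definition eps :: "nat \<Rightarrow> real" where "eps n = 1 / (8 * real n)"

definition eta :: "nat \<Rightarrow> real" where "eta n = 1 / (64 * real n ^ 4)"

text \<open>A line is encoded by its slope and a point on it. Lines of slope \<open>0, \<dots>, n - 1\<close> are represented by their point
on the vertical axis, so that grid points on a common line obtain the same element; for the extreme slopes
\<open>-1\<close> and \<open>n\<close> the grid point itself is recorded (its abscissa is positive), which makes the
element private to that point.\<close>

definition line_through :: "nat \<Rightarrow> int \<times> int \<Rightarrow> int \<Rightarrow> nat" where
  "line_through n p s = (case p of (x, y) \<Rightarrow>
     to_nat (if 0 \<le> s \<and> s < int n then (s, 0, y - s * x) else (s, x, y)))"

text \<open>The unperturbed intercept is \<open>t\<close>. The term quadratic in the slope bends every pencil into a concave chain.
This alone would give all points of a column the same corners; the term quadratic in \<open>t\<close> separates them, and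
it too is convex in the slope along a pencil, where \<open>t\<close> is an affine function of the slope.\<close>

definition line_intercept :: "nat \<Rightarrow> nat \<Rightarrow> real" where
  "line_intercept n e = (case from_nat e of (s, x, y) \<Rightarrow>
     let t = of_int (y - s * x) in t + eps n * (of_int s)\<^sup>2 + eta n * t\<^sup>2)"

definition line_slope :: "nat \<Rightarrow> real" where
  "line_slope e = (case from_nat e :: int \<times> int \<times> int of (s, x, y) \<Rightarrow> of_int s)"

definition grid :: "nat \<Rightarrow> (int \<times> int) set" where
  "grid n = {1..int n} \<times> {0..<(int n)\<^sup>2}"

definition pencil :: "nat \<Rightarrow> int \<times> int \<Rightarrow> nat set" where
  "pencil n p = line_through n p ` {-1..int n}"

text \<open>The parameter at which the lines of slopes \<open>s\<close> and \<open>s + 1\<close> through \<open>p\<close> meet.\<close>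

definition corner :: "nat \<Rightarrow> int \<times> int \<Rightarrow> int \<Rightarrow> real" where
  "corner n p s = (case p of (x, y) \<Rightarrow>
     of_int x - eps n * of_int (2 * s + 1) - eta n * of_int (x * ((2 * s + 1) * x - 2 * y)))"

lemma line_slope_through [simp]: "line_slope (line_through n p s) = of_int s"
  by (cases p) (simp add: line_slope_def line_through_def)

lemma weight_line_through:
  "weight (line_intercept n) line_slope (line_through n (x, y) s) l =
     of_int s * l + of_int (y - s * x) + eps n * (of_int s)\<^sup>2 + eta n * (of_int (y - s * x))\<^sup>2"
  by (simp add: weight_def line_slope_def line_intercept_def line_through_def Let_def)

lemma weight_succ_diff:
  "weight (line_intercept n) line_slope (line_through n p (s + 1)) l -
   weight (line_intercept n) line_slope (line_through n p s) l = l - corner n p s"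
  by (cases p) (simp add: weight_line_through corner_def power2_eq_square algebra_simps)

text \<open>On a pencil the perturbation is a quadratic polynomial in the slope with leading coefficient
\<open>eps n + eta n * x\<^sup>2\<close>, hence so is the weight at a fixed parameter. At a corner it takes the same value
at \<open>s\<close> and \<open>s + 1\<close>, which determines the difference.\<close>

lemma weight_diff_at_corner:
  "weight (line_intercept n) line_slope (line_through n (x, y) j) (corner n (x, y) s) -
   weight (line_intercept n) line_slope (line_through n (x, y) s) (corner n (x, y) s) =
   (eps n + eta n * (of_int x)\<^sup>2) * of_int ((j - s) * (j - s - 1))"
  by (simp add: weight_line_through corner_def power2_eq_square algebra_simps)

lemma finite_pencil [simp]: "finite (pencil n p)"
  by (simp add: pencil_def)

lemma pencil_nonempty: "pencil n p \<noteq> {}"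
  by (simp add: pencil_def)

lemma finite_grid [simp]: "finite (grid n)"
  by (simp add: grid_def)

lemma eps_eta_nonneg: "eps n \<ge> 0" "eta n \<ge> 0"
  by (simp_all add: eps_def eta_def)

lemma eta_term_le:
  assumes "n > 0" "(x, y) \<in> grid n" "s \<in> {-1..<int n}"
  shows "\<bar>eta n * of_int (x * ((2 * s + 1) * x - 2 * y))\<bar> \<le> eps n / 2"
proof -
  have x: "0 \<le> x" "x \<le> int n" and y: "0 \<le> y" "y \<le> int n * int n"
    using assms(2) by (auto simp: grid_def power2_eq_square)
  have s: "\<bar>2 * s + 1\<bar> \<le> 2 * int n" using assms(1,3) by auto
  have "\<bar>(2 * s + 1) * x\<bar> \<le> 2 * int n * int n"
    unfolding abs_mult using s x by (intro mult_mono) auto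
  then have "\<bar>(2 * s + 1) * x - 2 * y\<bar> \<le> 4 * int n * int n" using y by linarith
  then have "\<bar>x * ((2 * s + 1) * x - 2 * y)\<bar> \<le> int n * (4 * int n * int n)"
    unfolding abs_mult[of x] using x by (intro mult_mono) auto
  then have "real_of_int \<bar>x * ((2 * s + 1) * x - 2 * y)\<bar> \<le> real_of_int (int n * (4 * int n * int n))"
    by (simp only: of_int_le_iff)
  then have "\<bar>eta n * of_int (x * ((2 * s + 1) * x - 2 * y))\<bar> \<le>
      eta n * real_of_int (int n * (4 * int n * int n))"
    unfolding abs_mult[of "eta n"] of_int_abs using eps_eta_nonneg(2)[of n]
    by (simp add: mult_left_mono del: of_int_mult)
  also have "\<dots> = eps n / 2"
    using assms(1) by (simp add: eta_def eps_def field_simps power4_eq_xxxx)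
  finally show ?thesis .
qed

lemma corner_near:
  assumes "n > 0" "(x, y) \<in> grid n" "s \<in> {-1..<int n}"
  shows "\<bar>corner n (x, y) s - of_int x\<bar> < 1 / 2"
proof -
  have "real_of_int \<bar>2 * s + 1\<bar> \<le> real_of_int (2 * int n)"
    using assms(1,3) by (simp only: of_int_le_iff) auto
  then have "eps n * \<bar>of_int (2 * s + 1)\<bar> \<le> eps n * (2 * real n)"
    by (intro mult_left_mono eps_eta_nonneg) simp
  also have "\<dots> = 1 / 4" using assms(1) by (simp add: eps_def)
  finally have "\<bar>eps n * of_int (2 * s + 1)\<bar> \<le> 1 / 4"
    using eps_eta_nonneg(1)[of n] by (simp add: abs_mult)
  moreover have "eps n \<le> 1 / 8" using assms(1) by (simp add: eps_def field_simps)
  ultimately show ?thesis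
    using eta_term_le[OF assms] unfolding corner_def prod.case by linarith
qed

text \<open>The position of a corner is read off on three separate scales: its nearest integer is the abscissa, the offset at
scale \<open>eps n\<close> determines the slope, and the remaining offset at scale \<open>eta n\<close> determines the height,
on which it depends with the nonzero coefficient \<open>2 * x\<close>.\<close>

lemma inj_on_corner:
  assumes n: "n > 0"
  shows "inj_on (\<lambda>(p, s). corner n p s) (grid n \<times> {-1..<int n})"
proof (rule inj_onI)
  fix u v assume uv: "u \<in> grid n \<times> {-1..<int n}" "v \<in> grid n \<times> {-1..<int n}"
    "(case u of (p, s) \<Rightarrow> corner n p s) = (case v of (p, s) \<Rightarrow> corner n p s)"
  obtain x y s x' y' s' where u: "u = ((x, y), s)" and v: "v = ((x', y'), s')"
    by (metis surj_pair)
  have p: "(x, y) \<in> grid n" "s \<in> {-1..<int n}" and p': "(x', y') \<in> grid n" "s' \<in> {-1..<int n}"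
    and eq: "corner n (x, y) s = corner n (x', y') s'"
    using uv unfolding u v by simp_all
  have pos: "eps n > 0" "eta n > 0" using n by (simp_all add: eps_def eta_def)
  have "\<bar>real_of_int x - of_int x'\<bar> < 1"
    using corner_near[OF n p] corner_near[OF n p'] eq by linarith
  then have x: "x' = x" by linarith
  have "eps n * of_int (2 * s + 1) - eps n * of_int (2 * s' + 1) =
      eta n * of_int (x' * ((2 * s' + 1) * x' - 2 * y')) - eta n * of_int (x * ((2 * s + 1) * x - 2 * y))"
    using eq unfolding corner_def prod.case x by linarith
  then have "\<bar>eps n * of_int (2 * s + 1) - eps n * of_int (2 * s' + 1)\<bar> \<le> eps n"
    using eta_term_le[OF n p] eta_term_le[OF n p'] by linarith
  moreover have "eps n * of_int (2 * s + 1) - eps n * of_int (2 * s' + 1) = eps n * of_int (2 * (s - s'))"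
    by (simp add: algebra_simps)
  ultimately have "eps n * \<bar>of_int (2 * (s - s'))\<bar> \<le> eps n * 1"
    using pos(1) by (simp only: abs_mult abs_of_pos mult_1_right)
  then have "\<bar>of_int (2 * (s - s')) :: real\<bar> \<le> 1" using pos(1) by (simp only: mult_le_cancel_left_pos)
  then have "\<bar>2 * (s - s')\<bar> \<le> 1" by linarith
  then have s: "s' = s" by presburger
  have "eta n * of_int (x * ((2 * s + 1) * x - 2 * y)) = eta n * of_int (x * ((2 * s + 1) * x - 2 * y'))"
    using eq unfolding corner_def prod.case x s by linarith
  then have "x * ((2 * s + 1) * x - 2 * y) = x * ((2 * s + 1) * x - 2 * y')"
    using pos(2) by (simp only: mult_cancel_left of_int_eq_iff) auto
  moreover have "x \<noteq> 0" using p by (auto simp: grid_def)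
  ultimately have "y' = y" by simp
  then show "u = v" using x s by (simp add: u v)
qed

text \<open>A line that is not of extreme slope appears on the chain only between the corners with its two neighbours, and
both corners are close to \<open>x\<close>.\<close>

lemma active_near_point:
  assumes n: "n > 0" and p: "(x, y) \<in> grid n" and s: "0 \<le> s" "s < int n"
    and e: "line_through n (x, y) s \<in> active (line_intercept n) line_slope (pencil n (x, y)) l"
  shows "\<bar>l - of_int x\<bar> < 1 / 2"
proof -
  let ?w = "\<lambda>j. weight (line_intercept n) line_slope (line_through n (x, y) j) l"
  have le: "?w s \<le> ?w j" if "j \<in> {-1..int n}" for j
    using e that by (auto simp: active_iff pencil_def)
  have "l \<ge> corner n (x, y) s"
    using le[of "s + 1"] s weight_succ_diff[of n "(x, y)" s l] by simp
  moreover have "l \<le> corner n (x, y) (s - 1)"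
    using le[of "s - 1"] s weight_succ_diff[of n "(x, y)" "s - 1" l] by simp
  ultimately show ?thesis
    using corner_near[OF n p, of s] corner_near[OF n p, of "s - 1"] s
    unfolding abs_less_iff atLeastLessThan_iff by linarith
qed

text \<open>A private line belongs to one pencil only. A shared line active for two points forces
their integer abscissae to differ by less than \<open>1\<close>, and a line has one point for each abscissa.\<close>

lemma active_pencils_disjoint:
  assumes n: "n > 0" and p: "p \<in> grid n" "p' \<in> grid n"
    and e: "e \<in> active (line_intercept n) line_slope (pencil n p) l"
      "e \<in> active (line_intercept n) line_slope (pencil n p') l"
  shows "p = p'"
proof -
  obtain x y x' y' where xy: "p = (x, y)" "p' = (x', y')" by (cases p, cases p')
  have "e \<in> pencil n p" "e \<in> pencil n p'" using e by (simp_all add: active_def)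
  then obtain s s' where s: "e = line_through n p s" and s': "e = line_through n p' s'"
    unfolding pencil_def by (elim imageE)
  have ss: "s' = s" using s s' line_slope_through by (metis of_int_eq_iff)
  show ?thesis
  proof (cases "0 \<le> s \<and> s < int n")
    case True
    then have "\<bar>l - of_int x\<bar> < 1 / 2" "\<bar>l - of_int x'\<bar> < 1 / 2"
      using active_near_point[OF n] p e xy s s' ss by metis+
    then have "x = x'" by linarith
    then show ?thesis using s s' ss True xy by (simp add: line_through_def)
  next
    case False
    then show ?thesis using s s' ss xy by (auto simp: line_through_def)
  qed
qed

lemma active_sdr:
  assumes n: "n > 0"
  shows "\<exists>r. sdr (grid n) (pencil n) r \<and> (\<forall>p\<in>grid n.
    weight (line_intercept n) line_slope (r p) l =
    lower_envelope (line_intercept n) line_slope (pencil n p) l)"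
proof -
  let ?T = "\<lambda>p. active (line_intercept n) line_slope (pencil n p) l"
  have "\<exists>e. e \<in> ?T p" for p
    using active_nonempty[OF finite_pencil pencil_nonempty] by blast
  then obtain r where r: "\<And>p. r p \<in> ?T p" by metis
  have "inj_on r (grid n)"
    using active_pencils_disjoint[OF n] r by (intro inj_onI) metis
  then show ?thesis
    using r by (intro exI[of _ r]) (auto simp: sdr_def active_def)
qed

text \<open>The two extreme slopes supply the two disjoint transversals that make every deletion harmless to
the rank.\<close>

lemma private_sdr:
  assumes "\<not> (0 \<le> s \<and> s < int n)" "s \<in> {-1..int n}"
  shows "sdr (grid n) (pencil n) (\<lambda>p. line_through n p s)"
  using assms by (auto simp: sdr_def inj_on_def pencil_def line_through_def)

text \<open>By \<open>weight_diff_at_corner\<close> the excess of the slope \<open>i\<close> is a nonnegative multiple of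
\<open>(i - s) * (i - s - 1)\<close>, and a product of consecutive integers is never negative.\<close>

lemma both_active_at_corner:
  assumes s: "s \<in> {-1..<int n}" and j: "j \<in> {s, s + 1}"
  shows "line_through n p j \<in> active (line_intercept n) line_slope (pencil n p) (corner n p s)"
proof -
  obtain x y where p: "p = (x, y)" by (cases p)
  let ?w = "\<lambda>i. weight (line_intercept n) line_slope (line_through n p i) (corner n p s)"
  have diff: "?w i - ?w s = (eps n + eta n * (of_int x)\<^sup>2) * of_int ((i - s) * (i - s - 1))" for i
    unfolding p by (rule weight_diff_at_corner)
  have "?w j \<le> ?w i" for i
  proof -
    have "?w j = ?w s" using diff[of j] j by auto
    moreover have "(i - s) * (i - s - 1) \<ge> 0"
      by (cases "i \<ge> s + 1") (auto intro: mult_nonneg_nonneg mult_nonpos_nonpos)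
    then have "?w i - ?w s \<ge> 0"
      unfolding diff using eps_eta_nonneg[of n]
      by (intro mult_nonneg_nonneg) (simp_all del: of_int_mult)
    ultimately show ?thesis by simp
  qed
  moreover have "line_through n p j \<in> pencil n p"
    using s j by (auto simp: pencil_def)
  ultimately show ?thesis by (auto simp: active_iff pencil_def)
qed

lemma card_grid: "card (grid n) = n ^ 3"
  by (simp add: grid_def card_cartesian_product nat_power_eq)
    (simp add: power2_eq_square power3_eq_cube)

text \<open>A shared line through a grid point meets the vertical axis at an integer between \<open>-n\<^sup>2\<close> and \<open>n\<^sup>2\<close>, so
there are at most \<open>n * (2 * n\<^sup>2)\<close> of them, besides two private lines for each of the \<open>n\<^sup>3\<close> points.\<close>

lemma card_lines_le: "card (\<Union>p\<in>grid n. pencil n p) \<le> 4 * n ^ 3"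
proof -
  let ?N = "(int n)\<^sup>2"
  let ?S = "{0..<int n} \<times> {0::int} \<times> {- ?N..<?N}" and ?P = "{-1, int n} \<times> grid n"
  have "(\<Union>p\<in>grid n. pencil n p) \<subseteq> to_nat ` (?S \<union> ?P)"
  proof (clarify)
    fix e x y assume p: "(x, y) \<in> grid n" and "e \<in> pencil n (x, y)"
    then obtain s where s: "s \<in> {-1..int n}" "e = line_through n (x, y) s"
      by (auto simp: pencil_def)
    show "e \<in> to_nat ` (?S \<union> ?P)"
    proof (cases "0 \<le> s \<and> s < int n")
      case True
      have "0 \<le> s * x" "s * x \<le> int n * int n"
        using True p by (auto simp: grid_def intro!: mult_mono)
      then have "(s, 0, y - s * x) \<in> ?S"
        using True p unfolding grid_def power2_eq_square mem_Times_iff fst_conv snd_conv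
          atLeastLessThan_iff by (intro conjI insertI1; linarith)
      then show ?thesis using True s(2) by (simp add: line_through_def)
    next
      case False
      then have "(s, x, y) \<in> ?P" using s(1) p by auto
      then show ?thesis using False s(2) by (auto simp: line_through_def)
    qed
  qed
  then have "card (\<Union>p\<in>grid n. pencil n p) \<le> card (?S \<union> ?P)"
    by (intro order_trans[OF card_mono card_image_le]) auto
  also have "\<dots> \<le> card ?S + card ?P" by (rule card_Un_le)
  also have "card ?S = 2 * n ^ 3"
    by (simp add: card_cartesian_product nat_mult_distrib nat_power_eq power2_eq_square power3_eq_cube)
  also have "card ?P \<le> 2 * n ^ 3"
    by (simp add: card_cartesian_product card_grid card_insert_if)
  finally show ?thesis by simp
qed

theorem theorem3p11:
  "\<exists>c>0. \<forall>N. \<exists>(E :: nat set) \<F> I a b.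
     interdiction_instance E \<F> I a b \<and> card E \<ge> N \<and> matroid_rank \<F> \<ge> N \<and>
     real (card (changepoints I (interdiction_value E \<F> a b)))
       \<ge> c * real (card E) * real (matroid_rank \<F>) powr (1/3)"
proof (intro exI[of _ "1/12"] conjI allI)
  fix N :: nat
  define n where "n = Suc N"
  have n: "n > 0" by (simp add: n_def)
  \<comment> \<open>All corners lie within \<open>1 / 2\<close> of an integer in \<open>{1..n}\<close>.\<close>
  define I where "I = {0<..<real n + 1}"
  let ?U = "\<Union>p\<in>grid n. pencil n p"
  let ?p = "\<lambda>p. line_through n p (- 1)" and ?q = "\<lambda>p. line_through n p (int n)"
  have p: "sdr (grid n) (pencil n) ?p" and q: "sdr (grid n) (pencil n) ?q"
    by (auto intro!: private_sdr)
  have disj: "?p ` grid n \<inter> ?q ` grid n = {}"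
  proof -
    have "line_through n u (- 1) \<noteq> line_through n v (int n)" for u v
      by (metis line_slope_through of_int_eq_iff of_nat_0_le_iff neg_0_le_iff_le not_one_le_zero)
    then show ?thesis by blast
  qed
  have rat: "line_intercept n e \<in> \<rat> \<and> line_slope e \<in> \<rat>" for e
    by (auto simp: line_intercept_def line_slope_def eps_def eta_def Let_def split: prod.split)
  have "is_interval I" "bounded I" "open I"
    unfolding I_def by (auto simp: is_interval_oo)
  then obtain E :: "nat set" and \<F> a b M where inst: "interdiction_instance E \<F> I a b"
    and E: "card E = card ?U + 2" and k: "matroid_rank \<F> = card (grid n) + 1"
    and y: "\<forall>l\<in>I. interdiction_value E \<F> a b l =
      M + (\<Sum>p\<in>grid n. lower_envelope (line_intercept n) line_slope (pencil n p) l)"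
    using guarded_transversal_instance[OF finite_grid finite_pencil rat _ _ p q disj active_sdr[OF n],
      of I] by blast
  let ?y = "interdiction_value E \<F> a b"
  have cp: "changepoints I ?y = {l \<in> I. \<exists>p\<in>grid n.
      \<exists>e\<in>active (line_intercept n) line_slope (pencil n p) l.
      \<exists>e'\<in>active (line_intercept n) line_slope (pencil n p) l. line_slope e \<noteq> line_slope e'}"
    by (rule changepoints_sum_lower_envelopes[where M = M])
      (use y \<open>open I\<close> pencil_nonempty in auto)
  have fin: "finite (changepoints I ?y)"
    by (rule finite_changepoints_sum_lower_envelopes[where M = M and C = "grid n" and A = "pencil n"
          and a = "line_intercept n" and b = line_slope])
      (use y \<open>open I\<close> pencil_nonempty in auto)
  have "(\<lambda>(p, s). corner n p s) ` (grid n \<times> {-1..<int n}) \<subseteq> changepoints I ?y"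
  proof clarify
    fix x y s assume xy: "(x, y) \<in> grid n" and s: "s \<in> {-1..<int n}"
    have "1 \<le> x" "x \<le> int n" using xy by (auto simp: grid_def)
    then have "corner n (x, y) s \<in> I"
      using corner_near[OF n xy s] unfolding I_def greaterThanLessThan_iff abs_less_iff by linarith
    moreover have "line_slope (line_through n (x, y) s) \<noteq> line_slope (line_through n (x, y) (s + 1))"
      by simp
    ultimately show "corner n (x, y) s \<in> changepoints I ?y"
      unfolding cp using xy both_active_at_corner[OF s, of _ "(x, y)"]
      by (intro CollectI conjI bexI[of _ "(x, y)"] bexI[of _ "line_through n (x, y) s"]
          bexI[of _ "line_through n (x, y) (s + 1)"]) simp_all
  qed
  then have "card (grid n \<times> {-1..<int n}) \<le> card (changepoints I ?y)"
    using card_mono[OF fin] card_image[OF inj_on_corner[OF n]] by metis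
  then have count: "n ^ 3 * (n + 1) \<le> card (changepoints I ?y)"
    by (simp add: card_cartesian_product card_grid nat_add_distrib)
  have "n \<le> n ^ 3" using n by (simp add: self_le_power)
  moreover have "card (grid n) \<le> card ?U"
  proof -
    have "?p ` grid n \<subseteq> ?U" using p by (auto simp: sdr_def)
    then show ?thesis using sdr_image(2)[OF p] by (metis card_mono finite_UN_I finite_grid finite_pencil)
  qed
  ultimately have large: "N \<le> card E" "N \<le> matroid_rank \<F>"
    using E k n_def card_grid[of n] by auto
  \<comment> \<open>There are at most \<open>6 * n\<^sup>3\<close> elements and the rank is at most \<open>(2 * n)\<^sup>3\<close>, so \<open>1/12\<close> leaves \<open>n ^ 4\<close>.\<close>
  have one: "1 \<le> real n ^ 3" using n by simp
  have "real (card E) \<le> 4 * real n ^ 3 + 2"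
  proof -
    have "real (card E) \<le> real (4 * n ^ 3 + 2)"
      unfolding of_nat_le_iff E using card_lines_le[of n] by simp
    then show ?thesis by simp
  qed
  then have m: "real (card E) \<le> 6 * real n ^ 3" using one by linarith
  have "real (matroid_rank \<F>) powr (1/3) \<le> ((2 * real n) ^ 3) powr (1/3)"
    using one by (intro powr_mono2) (simp_all add: k card_grid power_mult_distrib)
  also have "\<dots> = 2 * real n"
    using n by (simp only: powr_powr flip: powr_numeral) simp
  finally have "real (card E) * real (matroid_rank \<F>) powr (1/3) \<le> (6 * real n ^ 3) * (2 * real n)"
    using m by (intro mult_mono) auto
  then have "1/12 * real (card E) * real (matroid_rank \<F>) powr (1/3) \<le> real n ^ 3 * real n"
    by simp
  also have "\<dots> \<le> real (n ^ 3 * (n + 1))" by (simp add: algebra_simps)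
  also have "\<dots> \<le> real (card (changepoints I ?y))" using count by (simp only: of_nat_le_iff)
  finally show "\<exists>(E :: nat set) \<F> I a b.
     interdiction_instance E \<F> I a b \<and> card E \<ge> N \<and> matroid_rank \<F> \<ge> N \<and>
     real (card (changepoints I (interdiction_value E \<F> a b)))
       \<ge> 1/12 * real (card E) * real (matroid_rank \<F>) powr (1/3)"
    using inst large by blast
qed simp

end
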